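(* Let $\mathcal{L}=(L,\wedge,\vee,0,1)$ be a complete lattice and $X\subseteq L\setminus\{1\}$ a non-empty subset. The following statements are equivalent: (a) $\mathcal{L}$ is an $X$-top lattice; (b) $V:(\mathcal{C}(L),\wedge,\widetilde{\vee})\to(\mathcal{P}(X),\cap,\cup)$ is an anti-homomorphism of lattices (i.e. $V(a\wedge b)=V(a)\cup V(b)$ and $V(a\,\widetilde{\vee}\,b)=V(a)\cap V(b)$ for all $a,b\in\mathcal{C}(L)$); (c) every element $p\in X$ is strongly irreducible in $(\mathcal{C}(L),\wedge)$; (d) $(\mathcal{C}(L),\wedge,\widetilde{\vee})$ is a distributive lattice and every element $p\in X$ is irreducible in $(\mathcal{C}(L),\wedge)$.
   Context: For a complete lattice $\mathcal{L}=(L,\wedge,\vee,0,1)$ and a non-empty $X\subseteq L\setminus\{1\}$, let $\mathcal{P}(X)$ be the power set of $X$ and define $V:L\to\mathcal{P}(X)$, $V(a)=\{p\in X\mid a\le p\}$, and $I:\mathcal{P}(X)\to L$, $I(\mathcal{A})=\bigwedge\mathcal{A}$ (with $I(\emptyset)=1$). $\mathcal{L}$ is called $X$-top if the family $V(L)=\{V(a)\mid a\in L\}$ is closed under finite unions. Put $\mathcal{C}(L)=\{a\in L\mid a=I(V(a))\}=\{I(\mathcal{A})\mid\mathcal{A}\subseteq X\}$. It contains $X$ and is closed under arbitrary meets of $L$; it is a complete lattice with meet $\wedge$ and with the join $\widetilde{\bigvee}Y:=I(V(\bigvee Y))=\bigwedge\{c\in\mathcal{C}(L)\mid y\le c\ \forall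 y\in Y\}$ for $Y\subseteq\mathcal{C}(L)$; write $a\,\widetilde{\vee}\,b$ for the binary join. An element $p$ of a lower semilattice $(S,\wedge)$ is irreducible if for all $a,b\in S$ with $p\le a$ and $p\le b$: $a\wedge b\le p$ implies $a\le p$ or $b\le p$. It is strongly irreducible if for all $a,b\in S$ (without restriction): $a\wedge b\le p$ implies $a\le p$ or $b\le p$. *)

theory Defs
  imports Main
begin

text \<open>
  The complete lattice is the universe of a type of class \<open>complete_lattice\<close>. Its sublattices
  and subsemilattices with new operations are carrier sets with explicit operations.
\<close>

definition V :: "'a::complete_lattice set \<Rightarrow> 'a \<Rightarrow> 'a set" where
  "V X a = {p \<in> X. a \<le> p}"

text \<open>\<open>\<Sqinter>{}\<close> is \<open>top\<close>, which is the convention \<open>I(\<emptyset>) = 1\<close>.\<close>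

definition I :: "'a::complete_lattice set \<Rightarrow> 'a" where
  "I A = Inf A"

text \<open>The empty union is allowed; it is \<open>V X top\<close> as soon as \<open>top \<notin> X\<close>.\<close>

definition X_top :: "'a::complete_lattice set \<Rightarrow> bool" where
  "X_top X \<longleftrightarrow> (\<forall>F. finite F \<and> F \<subseteq> range (V X) \<longrightarrow> \<Union>F \<in> range (V X))"

definition C :: "'a::complete_lattice set \<Rightarrow> 'a set" where
  "C X = {a. a = I (V X a)}"

definition C_Join :: "'a::complete_lattice set \<Rightarrow> 'a set \<Rightarrow> 'a" where
  "C_Join X Y = I (V X (Sup Y))"

definition C_join :: "'a::complete_lattice set \<Rightarrow> 'a \<Rightarrow> 'a \<Rightarrow> 'a" where
  "C_join X a b = C_Join X {a, b}"

definition lattice_on :: "'a set \<Rightarrow> ('a \<Rightarrow> 'a \<Rightarrow> 'a) \<Rightarrow> ('a \<Rightarrow> 'a \<Rightarrow> 'a) \<Rightarrow> bool" where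
  "lattice_on S m j \<longleftrightarrow>
     (\<forall>a\<in>S. \<forall>b\<in>S. m a b \<in> S \<and> j a b \<in> S) \<and>
     (\<forall>a\<in>S. \<forall>b\<in>S. m a b = m b a \<and> j a b = j b a) \<and>
     (\<forall>a\<in>S. \<forall>b\<in>S. \<forall>c\<in>S. m (m a b) c = m a (m b c) \<and> j (j a b) c = j a (j b c)) \<and>
     (\<forall>a\<in>S. \<forall>b\<in>S. m a (j a b) = a \<and> j a (m a b) = a)"

definition distributive_lattice_on ::
    "'a set \<Rightarrow> ('a \<Rightarrow> 'a \<Rightarrow> 'a) \<Rightarrow> ('a \<Rightarrow> 'a \<Rightarrow> 'a) \<Rightarrow> bool" where
  "distributive_lattice_on S m j \<longleftrightarrow>
     lattice_on S m j \<and> (\<forall>a\<in>S. \<forall>b\<in>S. \<forall>c\<in>S. m a (j b c) = j (m a b) (m a c))"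

definition lattice_antihom ::
    "'a set \<Rightarrow> ('a \<Rightarrow> 'a \<Rightarrow> 'a) \<Rightarrow> ('a \<Rightarrow> 'a \<Rightarrow> 'a) \<Rightarrow>
     'b set \<Rightarrow> ('b \<Rightarrow> 'b \<Rightarrow> 'b) \<Rightarrow> ('b \<Rightarrow> 'b \<Rightarrow> 'b) \<Rightarrow> ('a \<Rightarrow> 'b) \<Rightarrow> bool" where
  "lattice_antihom S m j T m' j' f \<longleftrightarrow>
     f ` S \<subseteq> T \<and>
     (\<forall>a\<in>S. \<forall>b\<in>S. f (m a b) = j' (f a) (f b)) \<and>
     (\<forall>a\<in>S. \<forall>b\<in>S. f (j a b) = m' (f a) (f b))"

text \<open>
  In the next two definitions \<open>S\<close> is meant to be closed under \<open>inf\<close>, so that it is a lower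
  semilattice with the induced meet and order.
\<close>

definition irreducible_in :: "'a::semilattice_inf set \<Rightarrow> 'a \<Rightarrow> bool" where
  "irreducible_in S p \<longleftrightarrow> p \<in> S \<and>
     (\<forall>a\<in>S. \<forall>b\<in>S. p \<le> a \<longrightarrow> p \<le> b \<longrightarrow> inf a b \<le> p \<longrightarrow> a \<le> p \<or> b \<le> p)"

definition strongly_irreducible_in :: "'a::semilattice_inf set \<Rightarrow> 'a \<Rightarrow> bool" where
  "strongly_irreducible_in S p \<longleftrightarrow> p \<in> S \<and>
     (\<forall>a\<in>S. \<forall>b\<in>S. inf a b \<le> p \<longrightarrow> a \<le> p \<or> b \<le> p)"

lemma C_eq_image_I: "C X = I ` Pow X"
proof (rule set_eqI, rule iffI)
  fix a assume "a \<in> C X"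
  then show "a \<in> I ` Pow X" by (auto simp: C_def V_def)
next
  fix a assume "a \<in> I ` Pow X"
  then obtain A where A: "A \<subseteq> X" "a = Inf A" by (auto simp: I_def)
  have "Inf (V X a) \<le> a"
    unfolding A(2) by (rule Inf_superset_mono) (use A in \<open>auto simp: V_def intro: Inf_lower\<close>)
  moreover have "a \<le> Inf (V X a)" by (auto simp: V_def intro: Inf_greatest)
  ultimately show "a \<in> C X" by (simp add: C_def I_def order.antisym)
qed

lemma subset_C: "X \<subseteq> C X"
proof
  fix p assume "p \<in> X"
  then have "p = I {p}" "{p} \<in> Pow X" by (auto simp: I_def)
  then show "p \<in> C X" unfolding C_eq_image_I by blast
qed

lemma C_Join_eq: "C_Join X Y = Inf {c \<in> C X. \<forall>y\<in>Y. y \<le> c}"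
proof (rule order.antisym)
  show "C_Join X Y \<le> Inf {c \<in> C X. \<forall>y\<in>Y. y \<le> c}"
  proof (rule Inf_greatest)
    fix c assume c: "c \<in> {c \<in> C X. \<forall>y\<in>Y. y \<le> c}"
    then have "Sup Y \<le> c" by (auto intro: Sup_least)
    then have "Inf (V X (Sup Y)) \<le> Inf (V X c)"
      by (intro Inf_superset_mono) (auto simp: V_def)
    then show "C_Join X Y \<le> c" using c by (simp add: C_def C_Join_def I_def)
  qed
next
  have "C_Join X Y \<in> C X" unfolding C_eq_image_I C_Join_def by (auto simp: V_def)
  moreover have "Sup Y \<le> C_Join X Y" by (auto simp: C_Join_def I_def V_def intro: Inf_greatest)
  ultimately show "Inf {c \<in> C X. \<forall>y\<in>Y. y \<le> c} \<le> C_Join X Y"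
    by (intro Inf_lower) (auto intro: order.trans[OF Sup_upper])
qed

end

theory Submission
  imports Defs
begin

text \<open>
  \<open>V\<close> is injective on \<open>C X\<close> and always turns the join of \<open>C X\<close> into an intersection, so the
  whole theorem turns on whether it also turns meets into unions; read pointwise, that is strong
  irreducibility of each \<open>p \<in> X\<close>. Under this condition \<open>C X\<close> inherits distributivity from the
  power set. Conversely, if \<open>inf a b \<le> p\<close> then distributivity gives \<open>inf (p \<squnion> a) (p \<squnion> b) \<le> p\<close> for
  the join \<open>\<squnion>\<close> of \<open>C X\<close>, so irreducibility of \<open>p\<close> is enough.
\<close>

lemma C_iff: "a \<in> C X \<longleftrightarrow> Inf (V X a) = a"
  by (auto simp: C_def I_def)

lemma le_Inf_V: "a \<le> Inf (V X a)"
  by (auto simp: V_def intro: Inf_greatest)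

text \<open>Members of \<open>V X a\<close> lie above its meet, and whatever lies above that meet
  lies above \<open>a\<close>. So every value of \<open>V X\<close> is attained on
  \<open>C X\<close>.\<close>

lemma V_Inf_V [simp]: "V X (Inf (V X a)) = V X a"
  using order.trans[OF le_Inf_V] by (auto simp: V_def intro: Inf_lower)

lemma Inf_V_in_C [simp]: "Inf (V X a) \<in> C X"
  by (simp add: C_iff)

text \<open>An element of \<open>C X\<close> is recovered as the meet of its \<open>V\<close>-set,
  and meets reverse inclusion.\<close>

lemma V_subset_iff: "a \<in> C X \<Longrightarrow> V X a \<subseteq> V X b \<longleftrightarrow> b \<le> a"
proof
  assume "a \<in> C X" and "V X a \<subseteq> V X b"
  then have "Inf (V X b) \<le> a" by (metis C_iff Inf_superset_mono)
  then show "b \<le> a" using le_Inf_V order.trans by blast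
qed (auto simp: V_def)

lemma V_eq_iff: "a \<in> C X \<Longrightarrow> b \<in> C X \<Longrightarrow> V X a = V X b \<longleftrightarrow> a = b"
  by (metis C_iff)

lemma inf_in_C:
  assumes "a \<in> C X" "b \<in> C X"
  shows "inf a b \<in> C X"
proof -
  have "inf a b = Inf (V X a \<union> V X b)"
    using assms by (simp add: C_iff Inf_union_distrib)
  then show ?thesis
    unfolding C_eq_image_I I_def by (auto simp: V_def)
qed

lemma C_join_eq: "C_join X a b = Inf (V X (sup a b))"
  by (simp add: C_join_def C_Join_def I_def)

lemma C_join_in_C [simp]: "C_join X a b \<in> C X"
  by (simp add: C_join_eq)

lemma V_C_join [simp]: "V X (C_join X a b) = V X a \<inter> V X b"
  unfolding C_join_eq V_Inf_V by (auto simp: V_def)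

lemma C_join_le_iff: "c \<in> C X \<Longrightarrow> C_join X a b \<le> c \<longleftrightarrow> a \<le> c \<and> b \<le> c"
  by (simp add: V_subset_iff[symmetric])

lemma le_C_join: "a \<le> C_join X a b" "b \<le> C_join X a b"
  using C_join_le_iff[of "C_join X a b" X a b] by simp_all

lemma lattice_on_C: "lattice_on (C X) inf (C_join X)"
proof -
  have commute: "C_join X a b = C_join X b a" for a b
    by (simp add: C_join_eq sup.commute)
  \<comment> \<open>By injectivity of \<open>V X\<close> on \<open>C X\<close>, it suffices to
    compare intersections.\<close>
  have assoc: "C_join X (C_join X a b) c = C_join X a (C_join X b c)" for a b c
    by (rule V_eq_iff[where X = X, THEN iffD1]) (auto simp: Int_assoc)
  have absorb1: "inf a (C_join X a b) = a" for a b
    by (simp add: inf_absorb1 le_C_join)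
  have absorb2: "C_join X a (inf a b) = a" if "a \<in> C X" for a b
    using that by (intro order.antisym) (simp_all add: C_join_le_iff le_C_join)
  show ?thesis
    unfolding lattice_on_def
    by (intro conjI ballI)
      (rule inf_in_C C_join_in_C inf.commute commute inf.assoc assoc absorb1 absorb2; assumption?)+
qed

text \<open>Membership of \<open>p\<close> in \<open>V X (inf a b)\<close> means
  \<open>inf a b \<le> p\<close>, so strong irreducibility is the inclusion from left to right; the
  reverse one always holds.\<close>

lemma strongly_irreducible_iff_V_inf:
  "(\<forall>p\<in>X. strongly_irreducible_in (C X) p) \<longleftrightarrow>
   (\<forall>a\<in>C X. \<forall>b\<in>C X. V X (inf a b) = V X a \<union> V X b)"
  using subset_C[of X]
  by (fastforce simp: strongly_irreducible_in_def V_def intro: le_infI1 le_infI2)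

lemma X_top_iff_V_inf:
  fixes X :: "'a::complete_lattice set"
  assumes "top \<notin> X"
  shows "X_top X \<longleftrightarrow> (\<forall>a\<in>C X. \<forall>b\<in>C X. V X (inf a b) = V X a \<union> V X b)"
proof
  assume top: "X_top X"
  show "\<forall>a\<in>C X. \<forall>b\<in>C X. V X (inf a b) = V X a \<union> V X b"
  proof (intro ballI equalityI)
    fix a b assume ab: "a \<in> C X" "b \<in> C X"
    have "\<Union>{V X a, V X b} \<in> range (V X)"
      using top unfolding X_top_def by (metis finite.emptyI finite.insertI empty_subsetI insert_subset
          rangeI)
    then obtain c where c: "V X a \<union> V X b = V X c" by auto
    \<comment> \<open>\<open>c\<close> may lie outside \<open>C X\<close>; that \<open>a\<close> and
      \<open>b\<close> lie in it is enough to turn inclusions into inequalities.\<close>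
    then have le: "c \<le> inf a b"
      using ab by (metis V_subset_iff Un_upper1 Un_upper2 le_inf_iff)
    then show "V X (inf a b) \<subseteq> V X a \<union> V X b"
      unfolding c using order.trans[OF le] by (auto simp: V_def)
    show "V X a \<union> V X b \<subseteq> V X (inf a b)"
      by (auto simp: V_def intro: le_infI1 le_infI2)
  qed
next
  assume V_inf: "\<forall>a\<in>C X. \<forall>b\<in>C X. V X (inf a b) = V X a \<union> V X b"
  \<comment> \<open>Arbitrary \<open>a\<close> and \<open>b\<close> are replaced by their closures
    in \<open>C X\<close>, which have the same \<open>V\<close>-sets.\<close>
  have union: "V X a \<union> V X b \<in> range (V X)" for a b
    using V_inf[rule_format, of "Inf (V X a)" "Inf (V X b)"] by (metis Inf_V_in_C V_Inf_V rangeI)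
  \<comment> \<open>Base case of the induction on \<open>F\<close>: the empty union.\<close>
  have empty: "{} = V X top"
    using assms by (auto simp: V_def top_unique)
  have "\<Union>F \<in> range (V X)" if "finite F" "F \<subseteq> range (V X)" for F
    using that by (induction F rule: finite_induct) (use union empty in auto)
  then show "X_top X"
    by (simp add: X_top_def)
qed

lemma distributive_lattice_on_C:
  assumes V_inf: "\<And>a b. a \<in> C X \<Longrightarrow> b \<in> C X \<Longrightarrow> V X (inf a b) = V X a \<union> V X b"
  shows "distributive_lattice_on (C X) inf (C_join X)"
proof -
  \<comment> \<open>Under \<open>V X\<close> this becomes distributivity of union over
    intersection.\<close>
  have "inf a (C_join X b c) = C_join X (inf a b) (inf a c)"
    if "a \<in> C X" "b \<in> C X" "c \<in> C X" for a b c
    by (rule V_eq_iff[where X = X, THEN iffD1]) (use that in \<open>auto simp: inf_in_C V_inf\<close>)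
  then show ?thesis
    by (simp add: distributive_lattice_on_def lattice_on_C)
qed

lemma irreducible_in_imp_strongly_irreducible_in:
  assumes dist: "distributive_lattice_on (C X) inf (C_join X)"
    and irr: "irreducible_in (C X) p"
  shows "strongly_irreducible_in (C X) p"
proof -
  have p: "p \<in> C X" using irr by (simp add: irreducible_in_def)
  have "a \<le> p \<or> b \<le> p" if ab: "a \<in> C X" "b \<in> C X" "inf a b \<le> p" for a b
  proof -
    \<comment> \<open>Joining with \<open>p\<close> moves both elements above \<open>p\<close>,
      where irreducibility applies.\<close>
    let ?a = "C_join X p a" and ?b = "C_join X p b"
    have d: "inf x (C_join X y z) = C_join X (inf x y) (inf x z)"
      if "x \<in> C X" "y \<in> C X" "z \<in> C X" for x y z
      using dist that by (simp add: distributive_lattice_on_def)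
    \<comment> \<open>Expands to the join of \<open>inf b p\<close> and \<open>inf b a\<close>, both
      below \<open>p\<close>.\<close>
    have "inf b ?a \<le> p"
      using ab p by (simp add: d C_join_le_iff inf.commute)
    \<comment> \<open>Expanding \<open>?b\<close> leaves \<open>inf ?a p\<close> and
      \<open>inf ?a b\<close>; the latter was just bounded.\<close>
    then have "inf ?a ?b \<le> p"
      using ab p by (simp add: d[of ?a p b] C_join_le_iff inf.commute)
    then have "?a \<le> p \<or> ?b \<le> p"
      using irr le_C_join(1) C_join_in_C unfolding irreducible_in_def by blast
    then show ?thesis
      using p by (auto simp: C_join_le_iff)
  qed
  then show ?thesis
    using p by (simp add: strongly_irreducible_in_def)
qed

theorem theorem2p2:
  fixes X :: "'a::complete_lattice set"
  assumes "X \<subseteq> UNIV - {top}" and "X \<noteq> {}"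
  shows "(X_top X \<longleftrightarrow> lattice_antihom (C X) inf (C_join X) (Pow X) (\<inter>) (\<union>) (V X)) \<and>
         (X_top X \<longleftrightarrow> (\<forall>p\<in>X. strongly_irreducible_in (C X) p)) \<and>
         (X_top X \<longleftrightarrow> distributive_lattice_on (C X) inf (C_join X) \<and>
                      (\<forall>p\<in>X. irreducible_in (C X) p))"
proof -
  let ?V_inf = "\<forall>a\<in>C X. \<forall>b\<in>C X. V X (inf a b) = V X a \<union> V X b"
  have a: "X_top X \<longleftrightarrow> ?V_inf"
    using assms by (intro X_top_iff_V_inf) auto
  \<comment> \<open>The join half holds for every \<open>X\<close> by \<open>V_C_join\<close>; only
    the meet half remains.\<close>
  have b: "lattice_antihom (C X) inf (C_join X) (Pow X) (\<inter>) (\<union>) (V X) \<longleftrightarrow> ?V_inf"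
    by (auto simp: lattice_antihom_def) (auto simp: V_def)
  note c = strongly_irreducible_iff_V_inf[of X]
  have "irreducible_in (C X) p" if "strongly_irreducible_in (C X) p" for p
    using that unfolding irreducible_in_def strongly_irreducible_in_def by blast
  then have d: "distributive_lattice_on (C X) inf (C_join X) \<and> (\<forall>p\<in>X. irreducible_in (C X) p)
      \<longleftrightarrow> ?V_inf"
    using c distributive_lattice_on_C[of X] irreducible_in_imp_strongly_irreducible_in[of X]
    by blast
  show ?thesis
    unfolding a b c d by simp
qed

end
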